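(* Let $q$ be an odd prime and $k\geq 2$ an integer. Then for every $n$ there exists a subset $A\subseteq \mathbb{F}_q^n$ of size $$|A|\ge (1-o(1))\cdot \binom{n}{\big\lceil \frac{k-1}{k} \lfloor \frac{k}{2k-1}q \rfloor \big \rceil}\Big/ \binom{\lfloor \frac{k}{2k-1}q \rfloor}{\big\lceil \frac{k-1}{k} \lfloor \frac{k}{2k-1}q \rfloor \big \rceil},$$ where $o(1)\to 0$ as $n\to\infty$ (with $q,k$ fixed), such that $A$ contains no $k$-right corner, i.e. there are no distinct vectors $x_0,x_1,\ldots,x_k\in A$ with $\langle x_i-x_0, x_j-x_0 \rangle=0$ for all $1\le i<j\le k$.
   Context: $\langle u,v\rangle=\sum_{i=1}^n u_iv_i$ denotes the standard dot product on $\mathbb{F}_q^n$. A $k$-right corner is a $(k+1)$-tuple of distinct vectors $x_0,\dots,x_k$ such that the vectors $x_1-x_0,\dots,x_k-x_0$ are pairwise orthogonal. *)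

theory Defs
  imports Complex_Main "HOL-Computational_Algebra.Primes" "Jordan_Normal_Form.Matrix"
begin

text \<open>
  Vectors of length \<open>n\<close> over a field are the elements of \<^const>\<open>carrier_vec\<close> \<open>n\<close>, and the
  standard dot product is \<^const>\<open>scalar_prod\<close>. A \<open>(k+1)\<close>-tuple is a function on
  \<open>nat\<close> of which only the values at \<open>0, \<dots>, k\<close> matter.
\<close>

definition right_corner :: "nat \<Rightarrow> nat \<Rightarrow> (nat \<Rightarrow> 'a::field vec) \<Rightarrow> bool" where
  "right_corner n k x \<longleftrightarrow>
     (\<forall>i\<in>{0..k}. x i \<in> carrier_vec n) \<and> inj_on x {0..k} \<and>
     (\<forall>i\<in>{1..k}. \<forall>j\<in>{1..k}. i < j \<longrightarrow>
        scalar_prod (x i - x 0) (x j - x 0) = 0)"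

definition right_corner_free :: "nat \<Rightarrow> nat \<Rightarrow> 'a::field vec set \<Rightarrow> bool" where
  "right_corner_free n k A \<longleftrightarrow>
     \<not> (\<exists>x. right_corner n k x \<and> (\<forall>i\<in>{0..k}. x i \<in> A))"

end

theory Submission
  imports Defs "HOL-Number_Theory.Residues" "HOL-Computational_Algebra.Polynomial"
begin

text \<open>
  Take for \<open>A\<close> the indicator vectors of a family of \<open>a\<close>-subsets that pairwise meet in fewer than
  \<open>b\<close> points. The product \<open>\<langle>x\<^sub>i - x\<^sub>0, x\<^sub>j - x\<^sub>0\<rangle>\<close> is then the residue of the number of points
  lying in \<open>S\<^sub>0\<close> only or in \<open>S\<^sub>i \<inter> S\<^sub>j\<close> only. This number is less than \<open>a + b \<le> q\<close>, so it vanishes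
  with the product, and a corner yields \<open>k\<close> disjoint subsets \<open>S\<^sub>0 - S\<^sub>i\<close> of \<open>S\<^sub>0\<close>, each with more
  than \<open>a / k\<close> points.

  That such families exist with asymptotically \<open>(n choose b) / (a choose b)\<close> members is Roedl's
  theorem. Instead of the nibble we use an algebraic blow-up of all \<open>a\<close>-subsets of a fixed set
  \<open>{..<M}\<close>. Every vertex is replaced by its copies \<open>(v, y)\<close>, with \<open>y\<close> from a group \<open>V\<close>. For every
  \<open>b\<close>-set \<open>B\<close> a linear functional with values modulo \<open>p\<close> splits the \<open>|V|\<^sup>b\<close> copies of \<open>B\<close> almost
  evenly among the \<open>N\<close> many \<open>a\<close>-sets \<open>e \<supseteq> B\<close>. The copies of \<open>e\<close> that are selected form an MDS code
  in \<open>V\<^sup>e\<close> all of whose \<open>b\<close>-subsets are assigned to \<open>e\<close>. One coordinate of \<open>V\<close> for every \<open>B\<close> leaves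
  enough room for a code satisfying all these constraints with \<open>|V|\<^sup>b / N\<close> words, up to rounding.
\<close>

section \<open>Vandermonde systems over the integers modulo m\<close>

definition packing :: "nat \<Rightarrow> nat \<Rightarrow> 'v set \<Rightarrow> 'v set set \<Rightarrow> bool" where
  "packing a b X F \<longleftrightarrow>
     F \<subseteq> {S. S \<subseteq> X \<and> card S = a} \<and> (\<forall>S\<in>F. \<forall>T\<in>F. S \<noteq> T \<longrightarrow> card (S \<inter> T) < b)"

text \<open>For \<open>v\<close> in \<open>E\<close> this is the derivative at \<open>v\<close> of
  the polynomial with simple roots \<open>E\<close>. Over a field its reciprocals span the vectors
  on which the first \<open>card E - 1\<close> moments vanish.\<close>

definition node_prod :: "nat set \<Rightarrow> nat \<Rightarrow> int" where
  "node_prod E v = (\<Prod>u\<in>E - {v}. int v - int u)"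

definition weight_det :: "(nat \<Rightarrow> int) \<Rightarrow> nat set \<Rightarrow> nat set \<Rightarrow> int" where
  "weight_det wt E B = (\<Sum>v\<in>E \<inter> B. wt v * (\<Prod>u\<in>E - {v}. node_prod E u))"

lemma moments_imp_poly_dvd:
  fixes z :: "nat \<Rightarrow> int" and g :: "int poly"
  assumes "\<And>j. j < n \<Longrightarrow> m dvd (\<Sum>v\<in>E. int v ^ j * z v)" and "degree g < n"
  shows "m dvd (\<Sum>v\<in>E. poly g (int v) * z v)"
proof -
  have "(\<Sum>v\<in>E. poly g (int v) * z v)
      = (\<Sum>v\<in>E. \<Sum>j\<le>degree g. coeff g j * (int v ^ j * z v))"
    by (simp add: poly_altdef sum_distrib_right mult.assoc)
  also have "\<dots> = (\<Sum>j\<le>degree g. coeff g j * (\<Sum>v\<in>E. int v ^ j * z v))"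
    by (subst sum.swap) (simp add: sum_distrib_left)
  finally show ?thesis
    using assms by (metis (mono_tags, lifting) atMost_iff dvd_mult dvd_sum le_less_trans)
qed

lemma coprime_node_prod:
  assumes "\<And>u v. u \<in> E \<Longrightarrow> v \<in> E \<Longrightarrow> u \<noteq> v \<Longrightarrow> coprime (int v - int u) m" and "v \<in> E"
  shows "coprime (node_prod E v) m"
  unfolding node_prod_def using assms by (intro prod_coprime_left) auto

lemma degree_node_poly:
  assumes "finite S" shows "degree (\<Prod>u\<in>S. [:- int u, 1:]) = card S"
  by (subst degree_prod_eq_sum_degree) auto

text \<open>Lagrange interpolation: the polynomial with zeros \<open>E - {v}\<close> isolates the
  term of \<open>v\<close>, with the unit \<open>node_prod E v\<close> as its coefficient. Only node
  differences have to be units, so composite moduli are allowed.\<close>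

lemma vandermonde_dvd:
  fixes z :: "nat \<Rightarrow> int"
  assumes fin: "finite E"
    and cop: "\<And>u v. u \<in> E \<Longrightarrow> v \<in> E \<Longrightarrow> u \<noteq> v \<Longrightarrow> coprime (int v - int u) m"
    and mom: "\<And>j. j < card E \<Longrightarrow> m dvd (\<Sum>v\<in>E. int v ^ j * z v)"
    and v: "v \<in> E"
  shows "m dvd z v"
proof -
  let ?g = "\<Prod>u\<in>E - {v}. [:- int u, 1:]"
  have "card E > 0" using fin v by (auto simp: card_gt_0_iff)
  then have "degree ?g < card E"
    using fin v by (subst degree_node_poly) auto
  then have "m dvd (\<Sum>w\<in>E. poly ?g (int w) * z w)"
    by (intro moments_imp_poly_dvd[OF mom])
  also have "(\<Sum>w\<in>E. poly ?g (int w) * z w) = (\<Sum>w\<in>{v}. poly ?g (int w) * z w)"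
    using fin v by (intro sum.mono_neutral_right) (auto simp: poly_prod)
  also have "\<dots> = node_prod E v * z v"
    by (simp add: poly_prod node_prod_def)
  finally show ?thesis
    using coprime_node_prod[of E m v, OF cop v] by (simp add: coprime_commute coprime_dvd_mult_right_iff)
qed

text \<open>One moment fewer than in \<open>vandermonde_dvd\<close> leaves a line of solutions; \<^const>\<open>weight_det\<close>
  is, up to a unit, the value of the weight functional on a generator of that line.\<close>

lemma weighted_vandermonde_dvd:
  fixes z :: "nat \<Rightarrow> int"
  assumes fin: "finite E"
    and cop: "\<And>u v. u \<in> E \<Longrightarrow> v \<in> E \<Longrightarrow> u \<noteq> v \<Longrightarrow> coprime (int v - int u) m"
    and det: "coprime (weight_det wt E B) m"
    and mom: "\<And>j. j < card E - 1 \<Longrightarrow> m dvd (\<Sum>v\<in>E. int v ^ j * z v)"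
    and wt: "m dvd (\<Sum>v\<in>E \<inter> B. wt v * z v)"
    and v: "v \<in> E"
  shows "m dvd z v"
proof -
  \<comment> \<open>A test polynomial vanishing at all nodes but \<open>v\<close> and
    \<open>w\<close> relates these two entries. The factor \<open>int w - int v\<close> completes
    its two values to the node products, up to sign.\<close>
  have const: "[z w * node_prod E w = z v * node_prod E v] (mod m)" if w: "w \<in> E" for w
  proof (cases "w = v")
    case False
    let ?g = "\<Prod>u\<in>E - {v} - {w}. [:- int u, 1:]"
    have "card E \<ge> 2"
      using card_mono[OF fin, of "{v, w}"] v w False by auto
    then have "degree ?g < card E - 1"
      using fin v w False by (subst degree_node_poly) auto
    then have "m dvd (\<Sum>x\<in>E. poly ?g (int x) * z x)"
      by (intro moments_imp_poly_dvd[OF mom])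
    also have "(\<Sum>x\<in>E. poly ?g (int x) * z x) = (\<Sum>x\<in>{v,w}. poly ?g (int x) * z x)"
      using fin v w by (intro sum.mono_neutral_right) (auto simp: poly_prod)
    also have "\<dots> = poly ?g (int v) * z v + poly ?g (int w) * z w"
      using False by simp
    finally have "m dvd (int w - int v) * (poly ?g (int v) * z v + poly ?g (int w) * z w)"
      by simp
    moreover have "node_prod E v = (int v - int w) * poly ?g (int v)"
      unfolding node_prod_def poly_prod
      using fin w False by (subst prod.remove[of _ w]) (auto simp: insert_commute Diff_insert2[symmetric])
    moreover have "node_prod E w = (int w - int v) * poly ?g (int w)"
      unfolding node_prod_def poly_prod
      using fin v False by (subst prod.remove[of _ v]) (auto simp: Diff_insert2[symmetric] insert_commute)
    moreover have "z w * ((int w - int v) * h) - z v * ((int v - int w) * g)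
        = (int w - int v) * (g * z v + h * z w)" for g h
      by (simp add: algebra_simps)
    ultimately have "m dvd z w * node_prod E w - z v * node_prod E v"
      by simp
    then show ?thesis by (simp add: cong_iff_dvd_diff)
  qed simp
  let ?P = "\<lambda>w. \<Prod>u\<in>E - {w}. node_prod E u"
  \<comment> \<open>Multiplying the weight relation by \<open>?D\<close> clears the denominators
    \<open>node_prod E w\<close>, so nothing has to be inverted modulo \<open>m\<close>.\<close>
  let ?D = "\<Prod>u\<in>E. node_prod E u"
  have D: "?D = node_prod E w * ?P w" if "w \<in> E" for w
    using fin that by (rule prod.remove)
  have "[(\<Sum>w\<in>E \<inter> B. wt w * z w) * ?D
       = (\<Sum>w\<in>E \<inter> B. wt w * (z v * node_prod E v) * ?P w)] (mod m)"
    unfolding sum_distrib_right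
  proof (rule cong_sum)
    fix w assume w: "w \<in> E \<inter> B"
    then have "[wt w * (z w * node_prod E w) * ?P w = wt w * (z v * node_prod E v) * ?P w] (mod m)"
      by (intro cong_mult const) auto
    with w D[of w] show "[wt w * z w * ?D = wt w * (z v * node_prod E v) * ?P w] (mod m)"
      by (simp add: algebra_simps)
  qed
  also have "(\<Sum>w\<in>E \<inter> B. wt w * (z v * node_prod E v) * ?P w)
      = z v * (node_prod E v * weight_det wt E B)"
    unfolding weight_det_def sum_distrib_left by (intro sum.cong) (auto simp: algebra_simps)
  finally have "m dvd z v * (node_prod E v * weight_det wt E B)"
    using wt by (metis cong_dvd_iff dvd_mult2)
  moreover have "coprime (node_prod E v * weight_det wt E B) m"
    using coprime_node_prod[of E m v, OF cop v] det by simp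
  ultimately show ?thesis
    by (simp add: coprime_commute coprime_dvd_mult_left_iff)
qed

section \<open>Weights and moduli that make all determinants invertible\<close>

lemma exists_generic_base:
  "\<exists>t>0. \<forall>E B. E \<subseteq> {..<M} \<longrightarrow> E \<inter> B \<noteq> {} \<longrightarrow> weight_det (\<lambda>v. t ^ v) E B \<noteq> 0"
proof -
  \<comment> \<open>With weights \<open>t ^ v\<close> the determinant is a polynomial in
    \<open>t\<close>, and different \<open>v\<close> contribute to different coefficients. Hence
    none of these finitely many polynomials is zero, and some positive \<open>t\<close> avoids all
    their roots.\<close>
  define Q where "Q = (\<lambda>(E, B). \<Sum>v\<in>E \<inter> B. monom (\<Prod>u\<in>E - {v}. node_prod E u) v :: int poly)"
  define I where "I = {(E, B). E \<subseteq> {..<M} \<and> B \<subseteq> {..<M} \<and> E \<inter> B \<noteq> {}}"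
  have "finite I"
    by (rule finite_subset[of _ "Pow {..<M} \<times> Pow {..<M}"]) (auto simp: I_def)
  have poly_Q: "poly (Q (E, B)) t = weight_det (\<lambda>v. t ^ v) E B" for E B t
    by (simp add: Q_def weight_det_def poly_sum poly_monom mult.commute)
  have "Q x \<noteq> 0" if "x \<in> I" for x
  proof -
    obtain E B where x: "x = (E, B)" by (cases x)
    with that have E: "E \<subseteq> {..<M}" and "E \<inter> B \<noteq> {}"
      by (auto simp: I_def)
    then obtain v where v: "v \<in> E" "v \<in> B" by auto
    have fin: "finite E" using E finite_subset by auto
    have "coeff (Q x) v = (\<Prod>u\<in>E - {v}. node_prod E u)"
      using fin v by (simp add: x Q_def coeff_sum)
    also have "\<dots> \<noteq> 0" using fin by (auto simp: node_prod_def)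
    finally show ?thesis by auto
  qed
  then have "finite (\<Union>x\<in>I. {t. poly (Q x) t = 0})"
    using \<open>finite I\<close> by (auto intro: poly_roots_finite)
  moreover have "infinite {0::int<..}" by (rule infinite_Ioi)
  ultimately obtain t where t: "t > 0" "t \<notin> (\<Union>x\<in>I. {t. poly (Q x) t = 0})"
    by (meson finite_subset greaterThan_iff subsetI)
  have "weight_det (\<lambda>v. t ^ v) E B \<noteq> 0" if "E \<subseteq> {..<M}" "E \<inter> B \<noteq> {}" for E B
  proof -
    have "E \<inter> (B \<inter> {..<M}) = E \<inter> B" using that by auto
    then have "(E, B \<inter> {..<M}) \<in> I" "weight_det (\<lambda>v. t ^ v) E B = weight_det (\<lambda>v. t ^ v) E (B \<inter> {..<M})"
      using that by (auto simp: I_def weight_det_def)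
    then show ?thesis using t by (force simp: poly_Q[symmetric])
  qed
  then show ?thesis using t by blast
qed

text \<open>The integers that have to be units are nonzero, and a modulus congruent to 1 modulo
  their product is coprime to each. A whole arithmetic progression of moduli is admissible, so
  \<open>p\<close> can be made large and \<open>r\<close> fitted to the number of points.\<close>

lemma exists_coprime_modulus:
  "\<exists>t K. K > 0 \<and>
    (\<forall>m. [m = 1] (mod (K::nat)) \<longrightarrow>
      coprime t (int m) \<and>
      (\<forall>u v. u < M \<longrightarrow> v < M \<longrightarrow> u \<noteq> v \<longrightarrow> coprime (int v - int u) (int m)) \<and>
      (\<forall>E B. E \<subseteq> {..<M} \<longrightarrow> E \<inter> B \<noteq> {} \<longrightarrow> coprime (weight_det (\<lambda>v. t ^ v) E B) (int m)))"
proof -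
  obtain t where t: "t > 0"
    "\<And>E B. E \<subseteq> {..<M} \<Longrightarrow> E \<inter> B \<noteq> {} \<Longrightarrow> weight_det (\<lambda>v. t ^ v) E B \<noteq> 0"
    using exists_generic_base by metis
  define X where "X = {t} \<union> (\<lambda>(u, v). int v - int u) ` {(u, v). u < M \<and> v < M \<and> u \<noteq> v}
     \<union> (\<lambda>(E, B). weight_det (\<lambda>v. t ^ v) E B) ` {(E, B). E \<subseteq> {..<M} \<and> B \<subseteq> {..<M} \<and> E \<inter> B \<noteq> {}}"
  have "finite {(u, v). u < M \<and> v < M \<and> u \<noteq> v}"
    by (rule finite_subset[of _ "{..<M} \<times> {..<M}"]) auto
  moreover have "finite {(E, B). E \<subseteq> {..<M} \<and> B \<subseteq> {..<M} \<and> E \<inter> B \<noteq> {}}"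
    by (rule finite_subset[of _ "Pow {..<M} \<times> Pow {..<M}"]) auto
  ultimately have "finite X" by (simp add: X_def)
  define K where "K = nat \<bar>\<Prod>x\<in>X. x\<bar>"
  have "0 \<notin> (\<lambda>(E, B). weight_det (\<lambda>v. t ^ v) E B) `
      {(E, B). E \<subseteq> {..<M} \<and> B \<subseteq> {..<M} \<and> E \<inter> B \<noteq> {}}"
    (is "0 \<notin> ?f ` ?I")
  proof
    assume "0 \<in> ?f ` ?I"
    then obtain x where x: "x \<in> ?I" "?f x = 0" by (metis (no_types, lifting) imageE)
    then show False using t(2)[of "fst x" "snd x"] by (simp add: case_prod_unfold)
  qed
  moreover have "0 \<notin> (\<lambda>(u, v). int v - int u) ` {(u, v). u < M \<and> v < M \<and> u \<noteq> v}"
    by auto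
  ultimately have "0 \<notin> X" using t(1) by (simp add: X_def)
  then have "K > 0" using \<open>finite X\<close> by (simp add: K_def)
  have dvdK: "x dvd int K" if "x \<in> X" for x
    using \<open>finite X\<close> that by (auto simp: K_def intro: dvd_prodI)
  have cop: "coprime x (int m)" if "x \<in> X" "[m = 1] (mod K)" for x m
  proof -
    have "coprime (int K) (int m)"
      using that(2) by (metis cong_imp_coprime cong_sym coprime_1_left coprime_commute coprime_int_iff)
    then show ?thesis using dvdK[OF that(1)] by (meson coprime_divisors dvd_refl)
  qed
  have "coprime (weight_det (\<lambda>v. t ^ v) E B) (int m)"
    if "[m = 1] (mod K)" "E \<subseteq> {..<M}" "E \<inter> B \<noteq> {}" for m E B
  proof -
    have "E \<inter> (B \<inter> {..<M}) = E \<inter> B" using that by auto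
    then have "weight_det (\<lambda>v. t ^ v) E B = weight_det (\<lambda>v. t ^ v) E (B \<inter> {..<M})"
      "E \<inter> (B \<inter> {..<M}) \<noteq> {}"
      using that by (auto simp: weight_det_def)
    then have "weight_det (\<lambda>v. t ^ v) E B \<in> X"
      using that(2) by (force simp: X_def)
    then show ?thesis using that cop by blast
  qed
  moreover have "coprime (int v - int u) (int m)"
    if "[m = 1] (mod K)" "u < M" "v < M" "u \<noteq> v" for m u v
    using that by (intro cop) (auto simp: X_def)
  moreover have "coprime t (int m)" if "[m = 1] (mod K)" for m
    using that by (intro cop) (auto simp: X_def)
  ultimately show ?thesis using \<open>K > 0\<close> by (intro exI[of _ t] exI[of _ K]) blast
qed

section \<open>Blowing up the complete hypergraph\<close>

text \<open>\<open>w\<close> is the length of the interval of residues reserved for one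
  \<open>a\<close>-set, and \<open>idx B\<close> numbers the \<open>a\<close>-sets containing
  \<open>B\<close>; by \<open>idx_le\<close> their intervals fit below \<open>p\<close>.\<close>

locale blowup =
  fixes M a b w p r :: nat and wt :: "nat \<Rightarrow> int" and idx :: "nat set \<Rightarrow> nat set \<Rightarrow> nat"
  assumes b_pos: "0 < b" and b_less: "b < a" and p_pos: "0 < p" and r_pos: "0 < r"
    and cop_p: "\<And>u v. u < M \<Longrightarrow> v < M \<Longrightarrow> u \<noteq> v \<Longrightarrow> coprime (int v - int u) (int p)"
    and cop_r: "\<And>u v. u < M \<Longrightarrow> v < M \<Longrightarrow> u \<noteq> v \<Longrightarrow> coprime (int v - int u) (int r)"
    and cop_wt: "\<And>v. coprime (wt v) (int p)"
    and cop_det: "\<And>E B. E \<subseteq> {..<M} \<Longrightarrow> E \<inter> B \<noteq> {} \<Longrightarrow> coprime (weight_det wt E B) (int p)"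
    and idx_inj: "\<And>B. B \<subseteq> {..<M} \<Longrightarrow> card B = b \<Longrightarrow>
          inj_on (idx B) {e. e \<subseteq> {..<M} \<and> card e = a \<and> B \<subseteq> e}"
    and idx_le: "\<And>B e. e \<subseteq> {..<M} \<Longrightarrow> card e = a \<Longrightarrow> B \<subseteq> e \<Longrightarrow> card B = b \<Longrightarrow> w * idx B e + w \<le> p"
begin

definition es :: "nat set set" where "es = {e. e \<subseteq> {..<M} \<and> card e = a}"

definition sub :: "nat set \<Rightarrow> nat set set" where "sub e = {B. B \<subseteq> e \<and> card B = b}"

text \<open>A point of the blow-up is a vertex \<open>v\<close> with a label, whose coordinates are indexed by the
  \<open>b\<close>-subsets of the vertices (modulus \<open>p\<close>) and by one further index \<open>{}\<close>, whose modulus \<open>r\<close>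
  serves only to adjust the number of points.\<close>

definition coords :: "nat set set" where "coords = insert {} (sub {..<M})"

definition md :: "nat set \<Rightarrow> nat" where "md B = (if B = {} then r else p)"

definition labels :: "(nat set \<Rightarrow> int) set" where
  "labels = (\<Pi>\<^sub>E B\<in>coords. {0..<int (md B)})"

text \<open>Only the coordinate \<open>B\<close> of the labels enters, so the constraints for
  different \<open>B\<close> concern disjoint sets of entries.\<close>

definition wsum :: "nat set \<Rightarrow> (nat \<Rightarrow> nat set \<Rightarrow> int) \<Rightarrow> int" where
  "wsum B y = (\<Sum>v\<in>B. wt v * y v B)"

definition moment :: "nat set \<Rightarrow> nat \<Rightarrow> (nat \<Rightarrow> nat set \<Rightarrow> int) \<Rightarrow> nat set \<Rightarrow> int" where
  "moment e j y B = (\<Sum>v\<in>e. int v ^ j * y v B)"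

text \<open>For fixed \<open>B\<close> the intervals of residues prescribed here for \<open>wsum B y\<close> are disjoint for the
  different \<open>e \<supseteq> B\<close>: the labelled copies of \<open>B\<close> are shared out among these \<open>e\<close>.\<close>

definition words :: "nat set \<Rightarrow> (nat \<Rightarrow> nat set \<Rightarrow> int) set" where
  "words e = {y \<in> e \<rightarrow>\<^sub>E labels. \<exists>\<rho><w. \<forall>B\<in>sub e. wsum B y mod int p = int (w * idx B e + \<rho>)}"

text \<open>All \<open>a - b\<close> moments in every coordinate would form the syndrome of an MDS
  code. The top moment is dropped at the coordinates in \<open>sub e\<close>, where
  \<open>words\<close> already restricts \<open>wsum B y\<close>.\<close>

definition check_index :: "nat set \<Rightarrow> (nat set \<times> nat) set" where
  "check_index e = coords \<times> {..<a - b} - sub e \<times> {a - b - 1}"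

text \<open>The sum of the dropped moments is kept as one value modulo \<open>p\<close>. It serves
  the coordinate \<open>B0\<close> when two words agree on \<open>B0\<close>, since
  \<open>wsum B0\<close> then carries no information about their difference.\<close>

definition check :: "nat set \<Rightarrow> (nat \<Rightarrow> nat set \<Rightarrow> int) \<Rightarrow> (nat set \<times> nat \<Rightarrow> int) \<times> int" where
  "check e y = (restrict (\<lambda>(B, j). moment e j y B mod int (md B)) (check_index e),
     (\<Sum>B\<in>sub e. moment e (a - b - 1) y B) mod int p)"

definition checks :: "nat set \<Rightarrow> ((nat set \<times> nat \<Rightarrow> int) \<times> int) set" where
  "checks e = (\<Pi>\<^sub>E (B, j)\<in>check_index e. {0..<int (md B)}) \<times> {0..<int p}"

section \<open>Sizes and membership of the basic sets\<close>

lemma finite_es [simp]: "finite es"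
  by (rule finite_subset[of _ "Pow {..<M}"]) (auto simp: es_def)

lemma card_es: "card es = M choose a"
  unfolding es_def using n_subsets[of "{..<M}" a] by simp

lemma finite_sub: "finite e \<Longrightarrow> finite (sub e)"
  by (rule finite_subset[of _ "Pow e"]) (auto simp: sub_def)

lemma card_sub: "finite e \<Longrightarrow> card (sub e) = card e choose b"
  unfolding sub_def by (rule n_subsets)

lemma finite_coords [simp]: "finite coords"
  by (simp add: coords_def finite_sub)

lemma empty_notin_sub [simp]: "{} \<notin> sub e"
  using b_pos by (simp add: sub_def)

lemma esD: "e \<in> es \<Longrightarrow> finite e \<and> card e = a \<and> e \<subseteq> {..<M}"
  by (auto simp: es_def intro: finite_subset)

lemma sub_coords: "e \<in> es \<Longrightarrow> sub e \<subseteq> coords"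
  by (auto simp: coords_def sub_def es_def)

lemma md_sub: "B \<in> sub e \<Longrightarrow> md B = p"
  using empty_notin_sub by (auto simp: md_def)

lemma md_pos: "0 < md B"
  using p_pos r_pos by (simp add: md_def)

lemma finite_labels [simp]: "finite labels"
  unfolding labels_def by (intro finite_PiE) auto

lemma finite_words: "finite e \<Longrightarrow> finite (words e)"
  by (rule finite_subset[of _ "e \<rightarrow>\<^sub>E labels"]) (auto simp: words_def intro: finite_PiE)

lemma card_labels: "card labels = (\<Prod>B\<in>coords. md B)"
  unfolding labels_def by (simp add: card_PiE)

lemma card_labels': "card labels = r * p ^ (M choose b)"
proof -
  have "(\<Prod>B\<in>sub {..<M}. md B) = (\<Prod>B\<in>sub {..<M}. p)"
    by (intro prod.cong) (auto simp: md_sub)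
  then show ?thesis
    by (simp add: card_labels coords_def finite_sub card_sub) (simp add: md_def)
qed

lemma card_labels_pos: "0 < card labels"
  by (simp add: card_labels md_pos prod_pos)

text \<open>The difference of the words lives on the \<open>a - b\<close> vertices of
  \<open>e - B0\<close>, and each coordinate has as many independent conditions as unknowns:
  \<open>a - b\<close> moments off \<open>sub e\<close>, one moment fewer plus the weighted sum on
  \<open>sub e\<close> apart from \<open>B0\<close>, and the summed top moments for
  \<open>B0\<close>.\<close>

lemma check_determines:
  assumes e: "e \<in> es" and y: "y \<in> e \<rightarrow>\<^sub>E labels" and y': "y' \<in> e \<rightarrow>\<^sub>E labels"
    and check: "check e y = check e y'"
    and wsum: "\<And>B. B \<in> sub e \<Longrightarrow> [wsum B y = wsum B y'] (mod int p)"
    and B0: "B0 \<in> sub e" and agree: "\<And>v. v \<in> B0 \<Longrightarrow> y v = y' v"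
  shows "y = y'"
proof -
  define c where "c = a - b"
  define E where "E = e - B0"
  define z where "z v B = y v B - y' v B" for v B
  have fin: "finite e" and card_e: "card e = a" and eM: "e \<subseteq> {..<M}"
    using esD[OF e] by auto
  have B0e: "B0 \<subseteq> e" "card B0 = b" using B0 by (auto simp: sub_def)
  have finB0: "finite B0" using B0e fin finite_subset by auto
  have finE: "finite E" and card_E: "card E = c"
    using fin B0e card_e finB0 by (auto simp: E_def c_def card_Diff_subset)
  have c: "0 < c" using b_less by (simp add: c_def)
  have z0: "z v B = 0" if "v \<in> B0" for v B using agree[OF that] by (simp add: z_def)
  have cop: "coprime (int v - int u) (int (md B))" if "u \<in> E" "v \<in> E" "u \<noteq> v" for u v B
    using that eM cop_p[of u v] cop_r[of u v] by (auto simp: E_def md_def)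
  have mom_diff: "moment e j y B - moment e j y' B = (\<Sum>v\<in>E. int v ^ j * z v B)" for j B
  proof -
    have "moment e j y B - moment e j y' B = (\<Sum>v\<in>e. int v ^ j * z v B)"
      by (simp add: moment_def z_def sum_subtractf algebra_simps)
    also have "\<dots> = (\<Sum>v\<in>E. int v ^ j * z v B)"
      using fin by (intro sum.mono_neutral_right) (auto simp: E_def z0)
    finally show ?thesis .
  qed
  have mom: "int (md B) dvd (\<Sum>v\<in>E. int v ^ j * z v B)" if "(B, j) \<in> check_index e" for B j
  proof -
    have "fst (check e y) (B, j) = fst (check e y') (B, j)" by (simp add: check)
    then have "[moment e j y B = moment e j y' B] (mod int (md B))"
      using that by (simp add: check_def cong_def)
    then show ?thesis by (simp add: cong_iff_dvd_diff mom_diff)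
  qed
  have mom_low: "int (md B) dvd (\<Sum>v\<in>E. int v ^ j * z v B)" if "B \<in> coords" "j < c - 1" for B j
    using that by (intro mom) (auto simp: check_index_def c_def)
  have off_sub: "int (md B) dvd z v B" if "B \<in> coords" "B \<notin> sub e" "v \<in> E" for v B
    using finE cop
  proof (rule vandermonde_dvd)
    fix j assume "j < card E"
    then show "int (md B) dvd (\<Sum>v\<in>E. int v ^ j * z v B)"
      using that by (intro mom) (auto simp: check_index_def card_E c_def)
  qed (use that in auto)
  have other: "int (md B) dvd z v B" if "B \<in> sub e" "B \<noteq> B0" "v \<in> E" for v B
    using finE cop
  proof (rule weighted_vandermonde_dvd)
    have "B \<subseteq> e" "card B = b" using that by (auto simp: sub_def)
    \<comment> \<open>A \<open>b\<close>-set other than \<open>B0\<close> reaches outside it, so its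
      weighted sum involves an unknown and \<open>cop_det\<close> applies.\<close>
    then have "\<not> B \<subseteq> B0"
      using that B0e finB0 card_subset_eq by metis
    then have "E \<inter> B \<noteq> {}" using \<open>B \<subseteq> e\<close> by (auto simp: E_def)
    then show "coprime (weight_det wt E B) (int (md B))"
      using eM that by (auto simp: E_def md_sub intro!: cop_det)
    have "wsum B y - wsum B y' = (\<Sum>v\<in>B. wt v * z v B)"
      by (simp add: wsum_def z_def sum_subtractf algebra_simps)
    also have "\<dots> = (\<Sum>v\<in>E \<inter> B. wt v * z v B)"
      using \<open>B \<subseteq> e\<close> fin by (intro sum.mono_neutral_right) (auto simp: E_def z0 intro: finite_subset)
    finally show "int (md B) dvd (\<Sum>v\<in>E \<inter> B. wt v * z v B)"
      using wsum[OF that(1)] that(1) by (simp add: cong_iff_dvd_diff md_sub)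
    show "int (md B) dvd (\<Sum>v\<in>E. int v ^ j * z v B)" if "j < card E - 1" for j
      using that \<open>B \<in> sub e\<close> sub_coords[OF e] by (intro mom_low) (auto simp: card_E)
  qed (use that in auto)
  have same: "int (md B0) dvd z v B0" if "v \<in> E" for v
    using finE cop
  proof (rule vandermonde_dvd)
    fix j assume j: "j < card E"
    show "int (md B0) dvd (\<Sum>v\<in>E. int v ^ j * z v B0)"
    proof (cases "j < c - 1")
      case True
      then show ?thesis using B0 sub_coords[OF e] by (intro mom_low) auto
    next
      case False
      then have j: "j = c - 1" using j by (simp add: card_E)
      have "snd (check e y) = snd (check e y')" by (simp add: check)
      then have "[(\<Sum>B\<in>sub e. moment e j y B) = (\<Sum>B\<in>sub e. moment e j y' B)] (mod int p)"
        by (simp add: check_def cong_def j c_def)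
      then have "int p dvd (\<Sum>B\<in>sub e. \<Sum>v\<in>E. int v ^ j * z v B)"
        by (simp add: cong_iff_dvd_diff sum_subtractf[symmetric] mom_diff)
      also have "(\<Sum>B\<in>sub e. \<Sum>v\<in>E. int v ^ j * z v B)
          = (\<Sum>v\<in>E. int v ^ j * z v B0) + (\<Sum>B\<in>sub e - {B0}. \<Sum>v\<in>E. int v ^ j * z v B)"
        using fin B0 by (intro sum.remove finite_sub)
      finally have "int p dvd \<dots>" .
      \<comment> \<open>The other coordinates already vanish modulo \<open>p\<close>, so the summed
        check yields the missing top moment of \<open>B0\<close>.\<close>
      moreover have "int p dvd (\<Sum>B\<in>sub e - {B0}. \<Sum>v\<in>E. int v ^ j * z v B)"
        using other md_sub by (intro dvd_sum dvd_mult) fastforce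
      ultimately show ?thesis
        using B0 by (simp add: md_sub dvd_add_left_iff)
    qed
  qed (use that in auto)
  have "y v B = y' v B" if "v \<in> e" "B \<in> coords" for v B
  proof (cases "v \<in> B0")
    case False
    then have "v \<in> E" using that by (simp add: E_def)
    then have "int (md B) dvd y v B - y' v B"
      using off_sub other same that unfolding z_def by blast
    then have "[y v B = y' v B] (mod int (md B))" by (simp add: cong_iff_dvd_diff)
    moreover have "y v \<in> labels" "y' v \<in> labels" using y y' that by auto
    then have "y v B \<in> {0..<int (md B)}" "y' v B \<in> {0..<int (md B)}"
      using that by (auto simp: labels_def)
    ultimately show ?thesis by (simp add: cong_def)
  qed (simp add: agree)
  moreover have "y v \<in> extensional coords" "y' v \<in> extensional coords" if "v \<in> e" for v
    using y y' that by (auto simp: labels_def PiE_def)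
  ultimately have "y v = y' v" if "v \<in> e" for v
    using that extensionalityI by metis
  then show ?thesis using y y' by (auto intro: PiE_ext)
qed

text \<open>Starting from \<open>card labels ^ (a - b)\<close> values of all moments, one factor
  \<open>p\<close> is lost for each member of \<open>sub e\<close> and one is regained by the sum.
  The lost factors stand on the left to avoid division.\<close>

lemma card_checks:
  assumes e: "e \<in> es"
  shows "card (checks e) * p ^ (a choose b) = card labels ^ (a - b) * p"
proof -
  have fin: "finite (sub e)" using esD[OF e] by (simp add: finite_sub)
  have sub: "sub e \<times> {a - b - 1} \<subseteq> coords \<times> {..<a - b}"
    using sub_coords[OF e] b_less by auto
  have "(\<Prod>(B, j)\<in>sub e \<times> {a - b - 1}. md B) = (\<Prod>x\<in>sub e \<times> {a - b - 1}. p)"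
    by (intro prod.cong) (auto simp: md_sub)
  also have "\<dots> = p ^ (a choose b)"
    using esD[OF e] by (simp add: card_sub card_cartesian_product)
  finally have "(\<Prod>(B, j)\<in>check_index e. md B) * p ^ (a choose b) = (\<Prod>(B, j)\<in>coords \<times> {..<a - b}. md B)"
    unfolding check_index_def using prod.subset_diff[OF sub, of "\<lambda>(B, j). md B"] by simp
  also have "\<dots> = card labels ^ (a - b)"
    by (simp add: prod.cartesian_product[symmetric] card_labels prod_power_distrib)
  finally have *: "(\<Prod>(B, j)\<in>check_index e. md B) * p ^ (a choose b) = card labels ^ (a - b)" .
  have "finite (check_index e)" by (simp add: check_index_def)
  then have "card (checks e) = (\<Prod>(B, j)\<in>check_index e. md B) * p"
    by (simp add: checks_def card_cartesian_product card_PiE case_prod_unfold)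
  then show ?thesis by (simp add: *[symmetric] mult.commute mult.left_commute)
qed

text \<open>Any label assignment becomes a word with a given offset after one entry is overwritten
  for each \<open>B\<close> in \<open>sub e\<close>. Recording the old entries makes this injective
  and costs the factor \<open>p ^ (a choose b)\<close>.\<close>

lemma card_words:
  assumes e: "e \<in> es"
  shows "w * card labels ^ a \<le> card (words e) * p ^ (a choose b)"
proof -
  have fin: "finite e" and card_e: "card e = a" using esD[OF e] by auto
  have fin_sub: "finite (sub e)" using fin by (rule finite_sub)
  have finB: "finite B" if "B \<in> sub e" for B using that fin finite_subset by (auto simp: sub_def)
  have Min_in: "Min B \<in> B" if "B \<in> sub e" for B
    by (rule Min_in[OF finB[OF that]]) (use that empty_notin_sub in auto)
  define ginv where "ginv v = (SOME g. [wt v * g = 1] (mod int p))" for v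
  have ginv: "[wt v * ginv v = 1] (mod int p)" for v
    unfolding ginv_def by (rule someI_ex[OF cong_solve_coprime_int[OF cop_wt]])
  define rest where "rest B y = (\<Sum>v\<in>B - {Min B}. wt v * y v B)" for B and y :: "nat \<Rightarrow> nat set \<Rightarrow> int"
  \<comment> \<open>The sum for \<open>B\<close> is corrected at the vertex \<open>Min B\<close> in
    the coordinate \<open>B\<close> alone, so the corrections for different \<open>B\<close> do not
    interfere and \<open>rest B\<close> keeps its value.\<close>
  define T where "T y \<rho> v B = (if v \<in> e \<and> B \<in> sub e \<and> v = Min B
      then ((int (w * idx B e + \<rho>) - rest B y) * ginv v) mod int p else y v B)" for y \<rho> v B
  define F where "F = (\<lambda>(y, \<rho>). (T y \<rho>, \<lambda>B\<in>sub e. y (Min B) B))"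
  have wsum: "wsum B y = wt (Min B) * y (Min B) B + rest B y" if "B \<in> sub e" for B y
    unfolding wsum_def rest_def by (rule sum.remove[OF finB[OF that] Min_in[OF that]])
  have rest_T: "rest B (T y \<rho>) = rest B y" if "B \<in> sub e" for B y \<rho>
    unfolding rest_def by (intro sum.cong) (auto simp: T_def)
  have wsum_T: "wsum B (T y \<rho>) mod int p = int (w * idx B e + \<rho>)"
    if B: "B \<in> sub e" and \<rho>: "\<rho> < w" for B y \<rho>
  proof -
    have "Min B \<in> e" using Min_in[OF B] B by (auto simp: sub_def)
    then have "wsum B (T y \<rho>)
        = wt (Min B) * (((int (w * idx B e + \<rho>) - rest B y) * ginv (Min B)) mod int p) + rest B y"
      using B by (simp add: wsum rest_T) (simp add: T_def)
    also have "[\<dots> = wt (Min B) * ((int (w * idx B e + \<rho>) - rest B y) * ginv (Min B)) + rest B y] (mod int p)"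
      by (intro cong_add cong_mult) auto
    also have "wt (Min B) * ((int (w * idx B e + \<rho>) - rest B y) * ginv (Min B)) + rest B y
        = (int (w * idx B e + \<rho>) - rest B y) * (wt (Min B) * ginv (Min B)) + rest B y"
      by (simp add: algebra_simps)
    also have "[\<dots> = (int (w * idx B e + \<rho>) - rest B y) * 1 + rest B y] (mod int p)"
      by (intro cong_add cong_mult ginv) auto
    finally have "[wsum B (T y \<rho>) = int (w * idx B e + \<rho>)] (mod int p)" by simp
    moreover have "w * idx B e + \<rho> < p"
      using idx_le[of e B] esD[OF e] B \<rho> by (auto simp: sub_def)
    ultimately show ?thesis by (metis cong_def mod_less zmod_int)
  qed
  have T_words: "T y \<rho> \<in> words e" if y: "y \<in> e \<rightarrow>\<^sub>E labels" and \<rho>: "\<rho> < w" for y \<rho>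
  proof -
    have "T y \<rho> v \<in> labels" if v: "v \<in> e" for v
    proof -
      have yv: "y v \<in> labels" using y v by auto
      show ?thesis unfolding labels_def
      proof (rule PiE_I)
        fix B assume "B \<in> coords"
        then show "T y \<rho> v B \<in> {0..<int (md B)}"
          using yv p_pos by (auto simp: T_def labels_def md_sub)
      next
        fix B assume "B \<notin> coords"
        then show "T y \<rho> v B = undefined"
          using yv sub_coords[OF e] by (auto simp: T_def labels_def)
      qed
    qed
    moreover have "T y \<rho> v = undefined" if "v \<notin> e" for v
      using PiE_arb[OF y that] that by (simp add: T_def fun_eq_iff)
    ultimately have "T y \<rho> \<in> e \<rightarrow>\<^sub>E labels" by auto
    then show ?thesis using wsum_T \<rho> by (auto simp: words_def)
  qed
  have "card ((e \<rightarrow>\<^sub>E labels) \<times> {..<w}) \<le> card (words e \<times> (sub e \<rightarrow>\<^sub>E {0..<int p}))"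
  proof (rule card_inj_on_le)
    show "inj_on F ((e \<rightarrow>\<^sub>E labels) \<times> {..<w})"
    proof (rule inj_onI, clarify)
      fix y \<rho> y' \<rho>'
      assume y: "y \<in> e \<rightarrow>\<^sub>E labels" "y' \<in> e \<rightarrow>\<^sub>E labels" and \<rho>: "\<rho> < w" "\<rho>' < w"
        and eq: "F (y, \<rho>) = F (y', \<rho>')"
      have T: "T y \<rho> = T y' \<rho>'" using eq by (simp add: F_def)
      have R: "y (Min B) B = y' (Min B) B" if "B \<in> sub e" for B
        using eq that by (auto simp: F_def dest: fun_cong[where x = B])
      have "y v B = y' v B" for v B
        using R[of B] fun_cong[OF fun_cong[OF T], of v B] by (auto simp: T_def split: if_splits)
      \<comment> \<open>Some \<open>B\<close> is required to read off the offset from the corrected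
        word.\<close>
      moreover have "sub e \<noteq> {}"
        using card_sub[OF fin] b_less by (auto simp: card_e)
      then obtain B where B: "B \<in> sub e" by auto
      have "int (w * idx B e + \<rho>) = int (w * idx B e + \<rho>')"
        using wsum_T[OF B \<rho>(1), of y] wsum_T[OF B \<rho>(2), of y'] T by simp
      ultimately show "y = y' \<and> \<rho> = \<rho>'" by (auto simp: fun_eq_iff)
    qed
    show "F ` ((e \<rightarrow>\<^sub>E labels) \<times> {..<w}) \<subseteq> words e \<times> (sub e \<rightarrow>\<^sub>E {0..<int p})"
    proof (clarsimp simp: F_def T_words)
      fix y B assume y: "y \<in> e \<rightarrow>\<^sub>E labels" and B: "B \<in> sub e"
      have "Min B \<in> e" using Min_in[OF B] B by (auto simp: sub_def)
      then have "y (Min B) \<in> labels" using y by auto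
      then have "y (Min B) B \<in> {0..<int (md B)}"
        using B sub_coords[OF e] by (auto simp: labels_def)
      then show "0 \<le> y (Min B) B \<and> y (Min B) B < int p"
        using md_sub[OF B] by simp
    qed
    show "finite (words e \<times> (sub e \<rightarrow>\<^sub>E {0..<int p}))"
      using fin_sub finite_words[OF fin] by (auto intro: finite_PiE)
  qed
  then show ?thesis
    using fin fin_sub by (simp add: card_cartesian_product card_funcsetE card_e card_sub mult.commute)
qed

section \<open>Codes and the packing formed by their graphs\<close>

lemma exists_code:
  assumes e: "e \<in> es"
  shows "\<exists>C \<subseteq> words e. (\<forall>y\<in>C. \<forall>y'\<in>C. check e y = check e y') \<and> w * card labels ^ b \<le> p * card C"
proof -
  \<comment> \<open>Pigeonhole over the values of \<open>check\<close>: in a largest fibre the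
    counts of words and checks combine to at least \<open>w * card labels ^ b / p\<close>
    words.\<close>
  define fib where "fib h = {y \<in> words e. check e y = h}" for h
  have fin: "finite e" using esD[OF e] by auto
  have fin_checks: "finite (checks e)"
    by (auto simp: checks_def check_index_def intro!: finite_PiE)
  have "check e y \<in> checks e" for y
    using md_pos p_pos by (auto simp: check_def checks_def)
  then have "words e = (\<Union>h\<in>checks e. fib h)" by (auto simp: fib_def)
  then have "card (words e) \<le> (\<Sum>h\<in>checks e. card (fib h))"
    using card_UN_le[OF fin_checks] by metis
  moreover obtain h where h: "h \<in> checks e" "card (fib h) = Max ((\<lambda>h. card (fib h)) ` checks e)"
  proof -
    have "Max ((\<lambda>h. card (fib h)) ` checks e) \<in> (\<lambda>h. card (fib h)) ` checks e"
      using fin_checks \<open>\<And>y. check e y \<in> checks e\<close> by (intro Max_in) auto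
    then show ?thesis using that by fastforce
  qed
  have "card (fib h') \<le> card (fib h)" if "h' \<in> checks e" for h'
    unfolding h(2) using fin_checks that by (intro Max_ge) auto
  ultimately have "card (words e) \<le> card (checks e) * card (fib h)"
    using sum_bounded_above[of "checks e" "\<lambda>h. card (fib h)" "card (fib h)"] by force
  then have "w * card labels ^ a \<le> card (checks e) * card (fib h) * p ^ (a choose b)"
    using card_words[OF e] by (meson le_trans mult_le_mono1)
  also have "\<dots> = card labels ^ (a - b) * (p * card (fib h))"
    using card_checks[OF e] by (metis mult.assoc mult.commute)
  finally have "card labels ^ (a - b) * (w * card labels ^ b) \<le> card labels ^ (a - b) * (p * card (fib h))"
    using b_less by (metis le_add_diff_inverse2 less_imp_le mult.left_commute power_add)
  then have "w * card labels ^ b \<le> p * card (fib h)"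
    using card_labels_pos by simp
  then show ?thesis by (intro exI[of _ "fib h"]) (auto simp: fib_def)
qed

theorem exists_packing:
  "\<exists>F. packing a b ({..<M} \<times> labels) F \<and>
     (M choose a) * w * card labels ^ b \<le> p * card F"
proof -
  obtain C where C: "\<And>e. e \<in> es \<Longrightarrow> C e \<subseteq> words e"
    "\<And>e y y'. e \<in> es \<Longrightarrow> y \<in> C e \<Longrightarrow> y' \<in> C e \<Longrightarrow> check e y = check e y'"
    "\<And>e. e \<in> es \<Longrightarrow> w * card labels ^ b \<le> p * card (C e)"
    using exists_code by metis
  define blk where "blk = (\<lambda>(e, y). (\<lambda>v. (v, y v)) ` e :: (nat \<times> (nat set \<Rightarrow> int)) set)"
  have card_blk: "card (blk (e, y)) = a" if "e \<in> es" for e y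
    using esD[OF that] by (simp add: blk_def card_image inj_on_def)
  have key: "(e, y) = (e', y')"
    if e: "e \<in> es" "e' \<in> es" and y: "y \<in> C e" "y' \<in> C e'"
      and int: "b \<le> card (blk (e, y) \<inter> blk (e', y'))" for e y e' y'
  proof -
    obtain S where S: "S \<subseteq> blk (e, y) \<inter> blk (e', y')" "card S = b"
      using int by (meson obtain_subset_with_card_n)
    define B where "B = fst ` S"
    have "snd x = y (fst x)" if "x \<in> S" for x
      using S that by (auto simp: blk_def)
    then have "inj_on fst S" by (auto simp: inj_on_def prod_eq_iff)
    then have "card B = b" using S by (simp add: B_def card_image)
    have "B \<subseteq> e" "B \<subseteq> e'" and agree: "\<And>v. v \<in> B \<Longrightarrow> y v = y' v"
      using S by (auto simp: B_def blk_def)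
    then have B: "B \<in> sub e" "B \<in> sub e'" using \<open>card B = b\<close> by (auto simp: sub_def)
    have yw: "y \<in> words e" "y' \<in> words e'" using y C(1) e by auto
    obtain \<rho> where \<rho>: "\<rho> < w" "\<And>B. B \<in> sub e \<Longrightarrow> wsum B y mod int p = int (w * idx B e + \<rho>)"
      using yw(1) by (auto simp: words_def)
    obtain \<rho>' where \<rho>': "\<rho>' < w" "\<And>B. B \<in> sub e' \<Longrightarrow> wsum B y' mod int p = int (w * idx B e' + \<rho>')"
      using yw(2) by (auto simp: words_def)
    have "wsum B y = wsum B y'" by (simp add: wsum_def agree)
    then have eq: "w * idx B e + \<rho> = w * idx B e' + \<rho>'"
      using \<rho>(2)[OF B(1)] \<rho>'(2)[OF B(2)] by (metis of_nat_eq_iff)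
    \<comment> \<open>Both offsets are below \<open>w\<close>, so division by \<open>w\<close>
      recovers the indices of the two \<open>a\<close>-sets from the common residue.\<close>
    have "(w * idx B e + \<rho>) div w = idx B e" "(w * idx B e' + \<rho>') div w = idx B e'"
      using \<rho>(1) \<rho>'(1) by auto
    then have "idx B e = idx B e'" using eq by simp
    moreover have "B \<subseteq> {..<M}" using \<open>B \<subseteq> e\<close> esD[OF e(1)] by auto
    ultimately have "e = e'"
      using inj_onD[OF idx_inj, of B e e'] e \<open>B \<subseteq> e\<close> \<open>B \<subseteq> e'\<close> \<open>card B = b\<close> by (auto simp: es_def)
    \<comment> \<open>Here it matters that one offset serves all of \<open>sub e\<close>: agreement
      on a single \<open>B\<close> now equates the weighted sums modulo \<open>p\<close> for every
      member.\<close>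
    then have "\<rho> = \<rho>'" using eq by simp
    have "y = y'"
    proof (rule check_determines[OF e(1)])
      show "y \<in> e \<rightarrow>\<^sub>E labels" "y' \<in> e \<rightarrow>\<^sub>E labels"
        using yw \<open>e = e'\<close> by (auto simp: words_def)
      show "check e y = check e y'" using C(2) e y \<open>e = e'\<close> by blast
      show "[wsum B y = wsum B y'] (mod int p)" if "B \<in> sub e" for B
        using \<rho>(2) \<rho>'(2) that \<open>e = e'\<close> \<open>\<rho> = \<rho>'\<close> by (simp add: cong_def)
    qed (use B agree in auto)
    then show ?thesis using \<open>e = e'\<close> by simp
  qed
  let ?F = "blk ` Sigma es C"
  have fin_C: "finite (C e)" if "e \<in> es" for e
    using finite_subset[OF C(1)[OF that]] finite_words esD[OF that] by blast
  have inj: "inj_on blk (Sigma es C)"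
  proof (rule inj_onI, clarify)
    fix e y e' y' assume *: "e \<in> es" "y \<in> C e" "e' \<in> es" "y' \<in> C e'" "blk (e, y) = blk (e', y')"
    then have "b \<le> card (blk (e, y) \<inter> blk (e', y'))" using card_blk b_less by simp
    then show "e = e' \<and> y = y'" using key[of e e' y y'] * by simp
  qed
  have "blk (e, y) \<subseteq> {..<M} \<times> labels" if "e \<in> es" "y \<in> C e" for e y
  proof -
    have "y \<in> e \<rightarrow>\<^sub>E labels" using C(1) that by (auto simp: words_def)
    then show ?thesis using esD[OF that(1)] by (auto simp: blk_def)
  qed
  then have "?F \<subseteq> {S. S \<subseteq> {..<M} \<times> labels \<and> card S = a}"
    using card_blk by auto
  moreover have "\<forall>S\<in>?F. \<forall>T\<in>?F. S \<noteq> T \<longrightarrow> card (S \<inter> T) < b"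
    using key by (auto simp: not_less[symmetric]) 
  moreover have "(M choose a) * w * card labels ^ b \<le> p * card ?F"
  proof -
    have "(M choose a) * w * card labels ^ b = (\<Sum>e\<in>es. w * card labels ^ b)"
      by (simp add: card_es)
    also have "\<dots> \<le> (\<Sum>e\<in>es. p * card (C e))"
      by (intro sum_mono C(3))
    also have "\<dots> = p * card (Sigma es C)"
      using fin_C by (simp add: card_SigmaI sum_distrib_left)
    finally show ?thesis by (simp add: card_image[OF inj])
  qed
  ultimately show ?thesis unfolding packing_def by blast
qed

end

section \<open>Asymptotically optimal packings\<close>

lemma packing_transport:
  assumes F: "packing a b X F" and fin: "finite X" and card: "card X \<le> n"
  shows "\<exists>F'. packing a b {..<n} F' \<and> card F' = card F"
proof -
  obtain f where f: "f ` X \<subseteq> {..<n}" "inj_on f X"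
    using card_le_inj[of X "{..<n}"] fin card by auto
  have FX: "F \<subseteq> Pow X" using F by (auto simp: packing_def)
  have card_f: "card (f ` S) = card S" if "S \<subseteq> X" for S
    using f(2) that by (meson card_image inj_on_subset)
  have "card (f ` S \<inter> f ` T) = card (S \<inter> T)" if "S \<in> F" "T \<in> F" for S T
  proof -
    have "S \<subseteq> X" "T \<subseteq> X" using FX that by auto
    then have "f ` (S \<inter> T) = f ` S \<inter> f ` T"
      by (rule inj_on_image_Int[OF f(2)])
    then show ?thesis using card_f[of "S \<inter> T"] \<open>S \<subseteq> X\<close> by auto
  qed
  then have "packing a b {..<n} ((`) f ` F)"
    unfolding packing_def
  proof (intro conjI ballI impI subsetI)
    fix S' assume "S' \<in> (`) f ` F"
    then obtain S where S: "S \<in> F" "S' = f ` S" by auto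
    then have "S \<subseteq> X" "card S = a" using F by (auto simp: packing_def)
    then show "S' \<in> {S. S \<subseteq> {..<n} \<and> card S = a}"
      using f(1) card_f S(2) by blast
  next
    fix S' T' assume "S' \<in> (`) f ` F" "T' \<in> (`) f ` F" "S' \<noteq> T'"
    then obtain S T where "S \<in> F" "S' = f ` S" "T \<in> F" "T' = f ` T" "S \<noteq> T" by auto
    then show "card (S' \<inter> T') < b"
      using \<open>\<And>T S. \<lbrakk>S \<in> F; T \<in> F\<rbrakk> \<Longrightarrow> card (f ` S \<inter> f ` T) = card (S \<inter> T)\<close> F
      by (auto simp: packing_def)
  qed
  moreover have "card ((`) f ` F) = card F"
    using inj_on_image_Pow[OF f(2)] FX by (meson card_image inj_on_subset)
  ultimately show ?thesis by blast
qed

text \<open>Settles the case \<open>a = b\<close>, which \<open>blowup\<close> excludes.\<close>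

lemma packing_all_subsets: "packing a a {..<n::nat} {S. S \<subseteq> {..<n} \<and> card S = a}"
proof -
  have "card (S \<inter> T) < a"
    if "S \<subseteq> {..<n}" "T \<subseteq> {..<n}" "card S = a" "card T = a" "S \<noteq> T" for S T
  proof (rule ccontr)
    have fin: "finite S" "finite T" using finite_subset[OF that(1)] finite_subset[OF that(2)] by simp_all
    assume "\<not> card (S \<inter> T) < a"
    then have "S \<inter> T = S" "S \<inter> T = T"
      using card_seteq[OF fin(1), of "S \<inter> T"] card_seteq[OF fin(2), of "S \<inter> T"] that fin by auto
    then show False using that(5) by simp
  qed
  then show ?thesis by (auto simp: packing_def)
qed

lemma exists_subset_index:
  "\<exists>idx :: nat set \<Rightarrow> nat set \<Rightarrow> nat. \<forall>B. B \<subseteq> {..<M} \<longrightarrow> card B = b \<longrightarrow>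
     inj_on (idx B) {e. e \<subseteq> {..<M} \<and> card e = a \<and> B \<subseteq> e} \<and>
     (\<forall>e. e \<subseteq> {..<M} \<longrightarrow> card e = a \<longrightarrow> B \<subseteq> e \<longrightarrow> idx B e < (M - b) choose (a - b))"
proof -
  have "\<exists>g :: nat set \<Rightarrow> nat. inj_on g {e. e \<subseteq> {..<M} \<and> card e = a \<and> B \<subseteq> e} \<and>
      (\<forall>e. e \<subseteq> {..<M} \<longrightarrow> card e = a \<longrightarrow> B \<subseteq> e \<longrightarrow> g e < (M - b) choose (a - b))"
    if B: "B \<subseteq> {..<M}" "card B = b" for B
  proof -
    let ?U = "{e. e \<subseteq> {..<M} \<and> card e = a \<and> B \<subseteq> e}"
    let ?V = "{X. X \<subseteq> {..<M} - B \<and> card X = a - b}"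
    have finB: "finite B" using B finite_subset by blast
    have fin: "finite ?U" "finite ?V"
      by (rule finite_subset[of _ "Pow {..<M}"]; auto)+
    have "card ?U \<le> card ?V"
    proof (rule card_inj_on_le[where f = "\<lambda>e. e - B"])
      show "inj_on (\<lambda>e. e - B) ?U" by (auto simp: inj_on_def)
      show "(\<lambda>e. e - B) ` ?U \<subseteq> ?V" using B finB by (auto simp: card_Diff_subset)
    qed (use fin in auto)
    also have "card ?V = (M - b) choose (a - b)"
      using n_subsets[of "{..<M} - B" "a - b"] B finB by (simp add: card_Diff_subset)
    finally have le: "card ?U \<le> (M - b) choose (a - b)" .
    obtain g where "bij_betw g ?U {0..<card ?U}"
      using ex_bij_betw_finite_nat[OF fin(1)] by blast
    then have g: "inj_on g ?U" "g ` ?U = {0..<card ?U}"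
      by (simp_all add: bij_betw_def)
    have "g e < (M - b) choose (a - b)" if "e \<in> ?U" for e
      using imageI[OF that, of g] le unfolding g(2) by simp
    then show ?thesis using g(1) by (intro exI[of _ g]) simp
  qed
  then have "\<forall>B. \<exists>g :: nat set \<Rightarrow> nat. B \<subseteq> {..<M} \<longrightarrow> card B = b \<longrightarrow>
      inj_on g {e. e \<subseteq> {..<M} \<and> card e = a \<and> B \<subseteq> e} \<and>
      (\<forall>e. e \<subseteq> {..<M} \<longrightarrow> card e = a \<longrightarrow> B \<subseteq> e \<longrightarrow> g e < (M - b) choose (a - b))"
    by simp
  then show ?thesis by (rule choice)
qed

text \<open>Intervals of length \<open>p div ((M - b) choose (a - b))\<close> leave room for one per
  index. \<open>K\<close> comes before \<open>p\<close> and \<open>r\<close>, so that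
  \<open>p\<close> can be fixed large and \<open>r\<close> can then grow with the number of
  points.\<close>

lemma packing_blowup:
  assumes "0 < b" "b < a"
  shows "\<exists>K>0. \<forall>p r. 0 < p \<longrightarrow> 0 < r \<longrightarrow> [p = 1] (mod K) \<longrightarrow> [r = 1] (mod K) \<longrightarrow>
    (\<exists>F. packing a b {..<M * (r * p ^ (M choose b))} F \<and>
      (M choose a) * (p div ((M - b) choose (a - b))) * (r * p ^ (M choose b)) ^ b \<le> p * card F)"
proof -
  obtain t K where K: "K > 0" and "\<forall>m. [m = 1] (mod (K::nat)) \<longrightarrow>
      coprime t (int m) \<and>
      (\<forall>u v. u < M \<longrightarrow> v < M \<longrightarrow> u \<noteq> v \<longrightarrow> coprime (int v - int u) (int m)) \<and>
      (\<forall>E B. E \<subseteq> {..<M} \<longrightarrow> E \<inter> B \<noteq> {} \<longrightarrow> coprime (weight_det (\<lambda>v. t ^ v) E B) (int m))"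
    using exists_coprime_modulus[of M] by (elim exE conjE)
  then have cop: "\<And>m. [m = 1] (mod (K::nat)) \<Longrightarrow> coprime t (int m)"
      "\<And>m u v. [m = 1] (mod K) \<Longrightarrow> u < M \<Longrightarrow> v < M \<Longrightarrow> u \<noteq> v \<Longrightarrow> coprime (int v - int u) (int m)"
      "\<And>m E B. [m = 1] (mod K) \<Longrightarrow> E \<subseteq> {..<M} \<Longrightarrow> E \<inter> B \<noteq> {} \<Longrightarrow>
         coprime (weight_det (\<lambda>v. t ^ v) E B) (int m)"
    by simp_all
  obtain idx :: "nat set \<Rightarrow> nat set \<Rightarrow> nat" where
    idx: "\<And>B. B \<subseteq> {..<M} \<Longrightarrow> card B = b \<Longrightarrow> inj_on (idx B) {e. e \<subseteq> {..<M} \<and> card e = a \<and> B \<subseteq> e}"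
      "\<And>B e. B \<subseteq> {..<M} \<Longrightarrow> card B = b \<Longrightarrow> e \<subseteq> {..<M} \<Longrightarrow> card e = a \<Longrightarrow> B \<subseteq> e \<Longrightarrow>
         idx B e < (M - b) choose (a - b)"
    using exists_subset_index[of M b a] by blast
  show ?thesis
  proof (intro exI[of _ K] conjI allI impI K)
    fix p r :: nat
    assume pr: "0 < p" "0 < r" "[p = 1] (mod K)" "[r = 1] (mod K)"
    define N where "N = (M - b) choose (a - b)"
    interpret blowup M a b "p div N" p r "\<lambda>v. t ^ v" idx
    proof
      fix B e assume e: "e \<subseteq> {..<M}" "card e = a" "B \<subseteq> e" "card B = b"
      then have "idx B e + 1 \<le> N" using idx(2)[OF order_trans[OF e(3,1)] e(4,1,2,3)] by (simp add: N_def)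
      then have "p div N * (idx B e + 1) \<le> p div N * N" by (rule mult_le_mono2)
      also have "\<dots> \<le> p" by simp
      finally show "p div N * idx B e + p div N \<le> p" by simp
    qed (use assms pr cop idx(1) in auto)
    obtain F where F: "packing a b ({..<M} \<times> labels) F"
      "(M choose a) * (p div N) * card labels ^ b \<le> p * card F"
      using exists_packing by blast
    have "card ({..<M} \<times> labels) = M * (r * p ^ (M choose b))"
      by (simp add: card_cartesian_product card_labels')
    then obtain F' where "packing a b {..<M * (r * p ^ (M choose b))} F'" "card F' = card F"
      using packing_transport[OF F(1)] by (metis finite_SigmaI finite_labels finite_lessThan order_refl)
    then show "\<exists>F. packing a b {..<M * (r * p ^ (M choose b))} F \<and>
      (M choose a) * (p div ((M - b) choose (a - b))) * (r * p ^ (M choose b)) ^ b \<le> p * card F"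
      using F(2) by (auto simp: N_def card_labels')
  qed
qed

section \<open>Asymptotic size of the packings\<close>

lemma power_diff_asymp:
  fixes D \<eta> :: real
  assumes "0 \<le> D" "0 < \<eta>"
  shows "\<exists>n0. \<forall>n\<ge>n0. D \<le> real n \<and> (1 - \<eta>) * real n ^ b \<le> (real n - D) ^ b"
proof -
  obtain n0 :: nat where n0: "D + real b * D / \<eta> + 1 \<le> real n0"
    using real_arch_simple by blast
  show ?thesis
  proof (intro exI[of _ n0] allI impI)
    fix n assume "n0 \<le> n"
    then have n: "D + real b * D / \<eta> + 1 \<le> real n" using n0 by linarith
    have nonneg: "0 \<le> real b * D / \<eta>" using assms by simp
    have n_pos: "0 < real n" and D: "D \<le> real n" using n nonneg assms by linarith+
    have "real b * D / \<eta> \<le> real n" using n assms by linarith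
    then have "real b * (D / real n) \<le> \<eta>"
      using assms n_pos by (simp add: field_simps)
    then have "1 - \<eta> \<le> 1 + real b * (- (D / real n))" by simp
    also have "\<dots> \<le> (1 + - (D / real n)) ^ b"
      using D n_pos by (intro Bernoulli_inequality) simp
    finally have "(1 - \<eta>) * real n ^ b \<le> (1 - D / real n) ^ b * real n ^ b"
      by (intro mult_right_mono) auto
    also have "\<dots> = (real n - D) ^ b"
      using n_pos by (simp add: power_mult_distrib[symmetric] algebra_simps)
    finally show "D \<le> real n \<and> (1 - \<eta>) * real n ^ b \<le> (real n - D) ^ b" using D by simp
  qed
qed

lemma power_le_binomial_fact: "b \<le> n \<Longrightarrow> (real n - real b) ^ b \<le> real (n choose b) * fact b"
proof -
  assume "b \<le> n"
  have "(real n - real b) ^ b = (\<Prod>i=0..<b. real n - real b)" by simp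
  also have "\<dots> \<le> (\<Prod>i=0..<b. real n - real i)"
    using \<open>b \<le> n\<close> by (intro prod_mono) auto
  also have "\<dots> = real (n choose b) * fact b"
    by (simp add: binomial_gbinomial gbinomial_prod_rev)
  finally show ?thesis .
qed

theorem asymptotic_packing:
  fixes \<delta> :: real
  assumes b: "0 < b" "b \<le> a" and \<delta>: "0 < \<delta>"
  shows "\<exists>n0. \<forall>n\<ge>n0. \<exists>F. packing a b {..<n} F \<and>
    (1 - \<delta>) * real (n choose b) \<le> real (card F) * real (a choose b)"
proof (cases "a = b")
  case True
  have "(1 - \<delta>) * real (n choose b) \<le> real (n choose b)" for n
    using \<delta> by (simp add: mult_left_le_one_le algebra_simps)
  then have "\<exists>F. packing a b {..<n} F \<and>
    (1 - \<delta>) * real (n choose b) \<le> real (card F) * real (a choose b)" for n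
    using packing_all_subsets[of a n] n_subsets[of "{..<n}" a] True
    by (intro exI[of _ "{S. S \<subseteq> {..<n} \<and> card S = a}"]) simp
  then show ?thesis by blast
next
  case False
  then have ba: "b < a" using b by simp
  \<comment> \<open>Three factors \<open>1 - \<eta>\<close> are lost: from \<open>M ^ b\<close> to
    \<open>(M choose b) * fact b\<close>, in rounding \<open>p div N\<close>, and in passing from
    \<open>n\<close> to a number of points that the blow-up provides. The cap at 1 keeps
    \<open>1 - \<eta>\<close> nonnegative.\<close>
  define \<eta> where "\<eta> = min (\<delta> / 3) 1"
  have \<eta>: "0 < \<eta>" "\<eta> \<le> 1" "3 * \<eta> \<le> \<delta>" using \<delta> by (auto simp: \<eta>_def min_def)
  have \<eta>3: "1 - \<delta> \<le> (1 - \<eta>) ^ 3"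
    using Bernoulli_inequality[of "- \<eta>" 3] \<eta> by simp
  obtain M where M: "a \<le> M" "(1 - \<eta>) * real M ^ b \<le> real (M choose b) * fact b"
  proof -
    obtain n0 where n0: "\<And>n. n \<ge> n0 \<Longrightarrow> (1 - \<eta>) * real n ^ b \<le> (real n - real b) ^ b"
      using power_diff_asymp[of "real b" \<eta> b] \<eta> by auto
    show ?thesis
      using that[of "max a n0"] n0[of "max a n0"] power_le_binomial_fact[of b "max a n0"] b by fastforce
  qed
  define N where "N = (M - b) choose (a - b)"
  obtain K where K: "K > 0" and blowup: "\<And>p r. 0 < p \<Longrightarrow> 0 < r \<Longrightarrow> [p = 1] (mod K) \<Longrightarrow> [r = 1] (mod K) \<Longrightarrow>
    \<exists>F. packing a b {..<M * (r * p ^ (M choose b))} F \<and>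
      (M choose a) * (p div N) * (r * p ^ (M choose b)) ^ b \<le> p * card F"
    using packing_blowup[OF b(1) ba, of M] unfolding N_def by blast
  obtain p where p: "0 < p" "[p = 1] (mod K)" "real N \<le> \<eta> * real p"
  proof -
    obtain l :: nat where "real N / \<eta> \<le> real l" using real_arch_simple by blast
    also have "real l \<le> real (1 + K * l)"
      using K by (simp del: of_nat_mult of_nat_add of_nat_Suc) (metis One_nat_def Suc_leI le_SucI mult.commute mult_le_mono2 nat_mult_1_right)
    finally have "real N \<le> \<eta> * real (1 + K * l)" using \<eta> by (simp add: field_simps)
    moreover have "[1 + K * l = 1] (mod K)" by (simp only: cong_def mod_mult_self2)
    ultimately show ?thesis using that[of "1 + K * l"] by simp
  qed
  have Np: "(1 - \<eta>) * real p \<le> real N * real (p div N)"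
  proof -
    have "0 < N" using M(1) by (simp add: N_def)
    have "p \<le> N * (p div N) + N"
      using mult_div_mod_eq[of N p] mod_less_divisor[OF \<open>0 < N\<close>, of p] by linarith
    then have "real p \<le> real N * real (p div N) + real N"
      by (metis of_nat_add of_nat_le_iff of_nat_mult)
    then show ?thesis using p(3) by (simp add: algebra_simps)
  qed
  \<comment> \<open>The number of points for \<open>r = 1\<close>; with \<open>M\<close> and
    \<open>p\<close> fixed, only \<open>r\<close> depends on \<open>n\<close>.\<close>
  define m0 where "m0 = M * p ^ (M choose b)"
  have m0: "0 < m0" using M ba p by (simp add: m0_def)
  obtain n0 where n0: "\<And>n. n \<ge> n0 \<Longrightarrow> real (m0 * (K + 1)) \<le> real n \<and>
      (1 - \<eta>) * real n ^ b \<le> (real n - real (m0 * (K + 1))) ^ b"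
    using power_diff_asymp[of "real (m0 * (K + 1))" \<eta> b] \<eta> by auto
  show ?thesis
  proof (intro exI[of _ n0] allI impI)
    fix n assume "n0 \<le> n"
    note n = n0[OF this]
    \<comment> \<open>The largest number congruent to 1 modulo \<open>K\<close> and at most
      \<open>n div m0\<close>. The congruence loses at most \<open>m0 * K\<close> points and the
      division at most \<open>m0\<close>, hence the constant \<open>m0 * (K + 1)\<close>.\<close>
    define r where "r = 1 + K * ((n div m0 - 1) div K)"
    have "m0 * (K + 1) \<le> n" using n by linarith
    then have "m0 \<le> n" by simp
    then have n_div: "1 \<le> n div m0" using m0 by (simp add: div_greater_zero_iff Suc_leI)
    have "K * ((n div m0 - 1) div K) \<le> n div m0 - 1" by simp
    then have "r \<le> n div m0" using n_div unfolding r_def by linarith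
    then have "m0 * r \<le> n"
      by (metis div_le_mono le_trans mult_le_mono2 times_div_less_eq_dividend)
    have "n div m0 - 1 \<le> K * ((n div m0 - 1) div K) + K"
      using mult_div_mod_eq[of K "n div m0 - 1"] mod_less_divisor[OF K, of "n div m0 - 1"] by linarith
    then have "n div m0 \<le> r + K" unfolding r_def by linarith
    then have "m0 * (n div m0) \<le> m0 * (r + K)" by (rule mult_le_mono2)
    moreover have "n \<le> m0 * (n div m0) + m0"
      using mult_div_mod_eq[of m0 n] mod_less_divisor[OF m0, of n] by linarith
    ultimately have "n \<le> m0 * r + m0 * (K + 1)" by (simp add: algebra_simps)
    then have "real n - real (m0 * (K + 1)) \<le> real (m0 * r)" by linarith
    then have nr: "(1 - \<eta>) * real n ^ b \<le> real (m0 * r) ^ b"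
      using n by (meson diff_ge_0_iff_ge order_trans power_mono)
    have r: "0 < r" "[r = 1] (mod K)"
      by (simp add: r_def) (simp only: r_def cong_def mod_mult_self2)
    define P where "P = r * p ^ (M choose b)"
    have MP: "M * P = m0 * r" by (simp add: P_def m0_def mult_ac)
    obtain F0 where F0: "packing a b {..<M * P} F0" "(M choose a) * (p div N) * P ^ b \<le> p * card F0"
      using blowup[OF p(1) r(1) p(2) r(2)] unfolding P_def by blast
    obtain F where F: "packing a b {..<n} F" "card F = card F0"
      using packing_transport[OF F0(1), of n] \<open>m0 * r \<le> n\<close> MP by auto
    \<comment> \<open>Counting pairs of a \<open>b\<close>-set inside an \<open>a\<close>-set turns
      \<open>(M choose a) / N\<close> into \<open>(M choose b) / (a choose b)\<close>.\<close>
    have choose: "real (M choose a) * real (a choose b) = real (M choose b) * real N"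
      using choose_mult[of b a M] b M by (simp add: N_def flip: of_nat_mult)
    have "real p * ((1 - \<delta>) * (real (n choose b) * fact b)) \<le> real p * ((1 - \<eta>) ^ 3 * real n ^ b)"
    proof (intro mult_left_mono mult_mono \<eta>3)
      show "real (n choose b) * fact b \<le> real n ^ b"
        using binomial_fact_pow[of n b] by (metis of_nat_fact of_nat_le_iff of_nat_mult of_nat_power)
    qed (use \<eta> in auto)
    also have "\<dots> = ((1 - \<eta>) * real p) * ((1 - \<eta>) * ((1 - \<eta>) * real n ^ b))"
      by (simp add: power3_eq_cube mult_ac)
    also have "\<dots> \<le> (real N * real (p div N)) * ((1 - \<eta>) * real (m0 * r) ^ b)"
      using \<eta> by (intro mult_mono Np mult_left_mono nr) auto
    also have "\<dots> = (real N * real (p div N)) * (((1 - \<eta>) * real M ^ b) * real P ^ b)"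
      unfolding MP[symmetric] by (simp add: power_mult_distrib mult_ac)
    also have "\<dots> \<le> (real N * real (p div N)) * ((real (M choose b) * fact b) * real P ^ b)"
      by (intro mult_left_mono mult_right_mono M) auto
    also have "\<dots> = (real (M choose b) * real N) * real (p div N) * real P ^ b * fact b"
      by (simp add: mult_ac)
    also have "\<dots> = real ((M choose a) * (p div N) * P ^ b) * real (a choose b) * fact b"
      unfolding choose[symmetric] by (simp add: mult_ac)
    also have "\<dots> \<le> real (p * card F) * real (a choose b) * fact b"
      using F0(2) F(2) by (intro mult_right_mono) (simp_all only: of_nat_le_iff of_nat_0_le_iff fact_ge_zero)
    finally have "(real p * fact b) * ((1 - \<delta>) * real (n choose b))
        \<le> (real p * fact b) * (real (card F) * real (a choose b))"
      by (simp add: mult_ac)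
    then have "(1 - \<delta>) * real (n choose b) \<le> real (card F) * real (a choose b)"
      using p(1) by (simp add: mult_le_cancel_left_pos)
    then show "\<exists>F. packing a b {..<n} F \<and>
        (1 - \<delta>) * real (n choose b) \<le> real (card F) * real (a choose b)"
      using F(1) by blast
  qed
qed

section \<open>Right corners\<close>

definition indicator_vec :: "nat \<Rightarrow> nat set \<Rightarrow> 'a::field vec" where
  "indicator_vec n S = vec n (\<lambda>i. if i \<in> S then 1 else 0)"

lemma inj_on_indicator_vec: "inj_on (indicator_vec n :: nat set \<Rightarrow> 'a::field vec) (Pow {..<n})"
proof (rule inj_onI)
  fix S T assume ST: "S \<in> Pow {..<n}" "T \<in> Pow {..<n}"
    and eq: "indicator_vec n S = (indicator_vec n T :: 'a vec)"
  have "i \<in> S \<longleftrightarrow> i \<in> T" if "i < n" for i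
    using arg_cong[OF eq, of "\<lambda>v. v $ i"] that by (simp add: indicator_vec_def split: if_splits)
  then show "S = T" using ST by auto
qed

text \<open>No coordinate contributes -1: at a point of \<open>R\<close> the product is 1 if the
  point lies in neither \<open>S\<close> nor \<open>T\<close>, at a point outside \<open>R\<close>
  if it lies in both, and otherwise 0.\<close>

lemma scalar_prod_indicator_vec_diff:
  assumes "R \<subseteq> {..<n}" "S \<subseteq> {..<n}" "T \<subseteq> {..<n}"
  shows "(indicator_vec n S - indicator_vec n R) \<bullet> (indicator_vec n T - indicator_vec n R)
    = (of_nat (card (R - S - T) + card (S \<inter> T - R)) :: 'a::field)"
proof -
  let ?D = "(R - S - T) \<union> (S \<inter> T - R)"
  have fin: "finite R" "finite S" using assms by (auto intro: finite_subset[OF _ finite_lessThan])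
  have "(indicator_vec n S - indicator_vec n R) \<bullet> (indicator_vec n T - indicator_vec n R)
      = (\<Sum>i\<in>{0..<n}. if i \<in> ?D then 1 else 0 :: 'a)"
    unfolding scalar_prod_def by (intro sum.cong) (auto simp: indicator_vec_def)
  also have "\<dots> = (\<Sum>i\<in>?D. 1)"
    using assms by (intro sum.mono_neutral_cong_right) auto
  also have "\<dots> = of_nat (card (R - S - T) + card (S \<inter> T - R))"
    using fin by (subst card_Un_disjoint[symmetric]) auto
  finally show ?thesis .
qed

lemma of_nat_eq_0_imp_zero:
  assumes "prime (card (UNIV :: 'a::{field,finite} set))" and "m < card (UNIV :: 'a set)"
    and "of_nat m = (0 :: 'a)"
  shows "m = 0"
proof -
  have "CHAR('a) \<noteq> 1" by simp
  then have "CHAR('a) = card (UNIV :: 'a set)"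
    using CHAR_dvd_CARD[where 'a = 'a] assms(1) by (auto simp: prime_nat_iff)
  then have "card (UNIV :: 'a set) dvd m"
    using assms(3) by (simp add: of_nat_eq_0_iff_char_dvd)
  then show ?thesis using assms(2) by (auto dest: dvd_imp_le)
qed

text \<open>By \<open>aq\<close> a vanishing product means that the count itself is zero; by
  \<open>k\<close> there is no room in an \<open>a\<close>-set for \<open>k\<close> disjoint subsets
  of size \<open>a + 1 - b\<close>.\<close>

lemma packing_right_corner_free:
  assumes q: "prime (card (UNIV :: 'a::{field,finite} set))"
    and F: "packing a b {..<n} F" and b: "b \<le> a"
    and aq: "a + b \<le> card (UNIV :: 'a set)" and k: "a < k * (a + 1 - b)"
  shows "right_corner_free n k (indicator_vec n ` F :: 'a vec set)"
  unfolding right_corner_free_def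
proof (rule notI, elim exE conjE)
  fix x :: "nat \<Rightarrow> 'a vec"
  assume corner: "right_corner n k x" and "\<forall>i\<in>{0..k}. x i \<in> indicator_vec n ` F"
  then have "\<forall>i\<in>{0..k}. \<exists>S\<in>F. x i = indicator_vec n S" by blast
  then obtain S where S: "\<And>i. i \<le> k \<Longrightarrow> S i \<in> F" "\<And>i. i \<le> k \<Longrightarrow> x i = indicator_vec n (S i)"
    by (metis atLeastAtMost_iff le0)
  have Sn: "S i \<subseteq> {..<n}" "card (S i) = a" "finite (S i)" if "i \<le> k" for i
    using S(1)[OF that] F by (auto simp: packing_def intro: finite_subset)
  have S_int: "card (S i \<inter> S j) < b" if "i \<le> k" "j \<le> k" "i \<noteq> j" for i j
  proof -
    have "x i \<noteq> x j" using corner that by (auto simp: right_corner_def inj_on_def)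
    then have "S i \<noteq> S j" using S(2) that by auto
    then show ?thesis using F S(1) that by (simp add: packing_def)
  qed
  have disj: "(S 0 - S i) \<inter> (S 0 - S j) = {}" if ij: "1 \<le> i" "i < j" "j \<le> k" for i j
  proof -
    let ?m = "card (S 0 - S i - S j) + card (S i \<inter> S j - S 0)"
    have "(x i - x 0) \<bullet> (x j - x 0) = 0"
      using corner ij by (auto simp: right_corner_def)
    then have "of_nat ?m = (0 :: 'a)"
      using scalar_prod_indicator_vec_diff[of "S 0" n "S i" "S j", where 'a = 'a] S(2) Sn(1) ij by simp
    moreover have "card (S 0 - S i - S j) \<le> a"
      using card_mono[of "S 0" "S 0 - S i - S j"] Sn[of 0] by auto
    moreover have "card (S i \<inter> S j - S 0) < b"
      using card_mono[of "S i \<inter> S j" "S i \<inter> S j - S 0"] Sn[of i] S_int[of i j] ij by force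
    ultimately have "?m = 0"
      using aq by (intro of_nat_eq_0_imp_zero[where 'a = 'a] q) auto
    then have "S 0 - S i - S j = {}" using Sn[of 0] by simp
    then show ?thesis by auto
  qed
  have large: "a + 1 - b \<le> card (S 0 - S i)" if "i \<in> {1..k}" for i
  proof -
    have "card (S 0 - S i) = a - card (S 0 \<inter> S i)"
      using Sn[of 0] by (simp add: card_Diff_subset_Int)
    then show ?thesis using S_int[of 0 i] that by simp
  qed
  have "k * (a + 1 - b) \<le> (\<Sum>i\<in>{1..k}. card (S 0 - S i))"
    using sum_mono[of "{1..k}", OF large] by simp
  also have "\<dots> = card (\<Union>i\<in>{1..k}. S 0 - S i)"
  proof (rule card_UN_disjoint[symmetric])
    show "\<forall>i\<in>{1..k}. \<forall>j\<in>{1..k}. i \<noteq> j \<longrightarrow> (S 0 - S i) \<inter> (S 0 - S j) = {}"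
      using disj by (metis Int_commute atLeastAtMost_iff linorder_neqE_nat)
  qed (use Sn[of 0] in auto)
  also have "\<dots> \<le> card (S 0)" using Sn[of 0] by (intro card_mono) auto
  finally show False using k Sn[of 0] by simp
qed

text \<open>The ceiling gives \<open>k * (b - 1) < (k - 1) * a\<close>, which rearranges to the last
  claim. Adding \<open>k * a\<close> and using \<open>(2 * k - 1) * a \<le> k * q\<close> from the
  floor gives \<open>a + b - 1 < q\<close>, and integrality finishes.\<close>

lemma corner_parameters:
  fixes q k a b :: nat
  assumes q: "q \<ge> 2" and k: "k \<ge> 2"
    and a: "a = nat \<lfloor>real k / (2 * real k - 1) * real q\<rfloor>"
    and b: "b = nat \<lceil>(real k - 1) / real k * real a\<rceil>"
  shows "0 < b" "b \<le> a" "a + b \<le> q" "a < k * (a + 1 - b)"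
proof -
  have k': "0 < 2 * real k - 1" "0 < real k" using k by auto
  define X where "X = real k / (2 * real k - 1) * real q"
  define Y where "Y = (real k - 1) / real k * real a"
  have "1 \<le> X"
  proof -
    have "2 * real k - 1 \<le> real k * 2" by simp
    also have "\<dots> \<le> real k * real q" using q by (intro mult_left_mono) auto
    finally show ?thesis using k' by (simp add: X_def field_simps)
  qed
  then have "1 \<le> \<lfloor>X\<rfloor>" by simp
  then have a1: "1 \<le> a" unfolding a X_def[symmetric] by linarith
  have "real a \<le> X" unfolding a X_def[symmetric] using \<open>1 \<le> X\<close> by (simp add: of_nat_nat)
  then have ak: "real a * (2 * real k - 1) \<le> real k * real q"
    using k' by (simp add: X_def field_simps)
  have Y0: "0 < Y" using a1 k by (simp add: Y_def)
  then have "1 \<le> \<lceil>Y\<rceil>" by linarith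
  then have b1: "0 < b" unfolding b Y_def[symmetric] by linarith
  have "real b = of_int \<lceil>Y\<rceil>" unfolding b Y_def[symmetric] using \<open>1 \<le> \<lceil>Y\<rceil>\<close> by simp
  then have "real b < Y + 1" by linarith
  moreover have kY: "real k * Y = (real k - 1) * real a" using k' by (simp add: Y_def)
  ultimately have "real k * real b < (real k - 1) * real a + real k"
    using mult_strict_left_mono[of "real b" "Y + 1" "real k"] k' by (simp add: algebra_simps)
  then have kb: "real k * (real b - 1) < (real k - 1) * real a" by (simp add: algebra_simps)
  have "real k * (real b - 1) < real k * real a"
    using kb by (simp add: algebra_simps)
  then have "real b - 1 < real a" using k' by (simp add: mult_less_cancel_left_pos)
  then show ba: "b \<le> a" by linarith
  have "real k * (real a + real b - 1) < real k * real q"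
    using kb ak by (simp add: algebra_simps)
  then have "real a + real b - 1 < real q" using k' by (simp add: mult_less_cancel_left_pos)
  then show "a + b \<le> q" by linarith
  have "real a < real k * (real a + 1 - real b)"
    using kb by (simp add: algebra_simps)
  also have "\<dots> = real (k * (a + 1 - b))" using ba by (simp add: of_nat_diff)
  finally show "a < k * (a + 1 - b)" by linarith
  show "0 < b" by (rule b1)
qed

theorem theorem1p3:
  fixes q k a b :: nat
  assumes "prime q" and "odd q" and "card (UNIV :: 'a::{field,finite} set) = q"
    and "k \<ge> 2"
    and "a = nat \<lfloor>real k / (2 * real k - 1) * real q\<rfloor>"
    and "b = nat \<lceil>(real k - 1) / real k * real a\<rceil>"
  shows "\<exists>\<epsilon> :: nat \<Rightarrow> real. \<epsilon> \<longlonglongrightarrow> 0 \<and>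
    (\<forall>n. \<exists>A :: 'a vec set. A \<subseteq> carrier_vec n \<and>
       real (card A) \<ge> (1 - \<epsilon> n) * real (n choose b) / real (a choose b) \<and>
       right_corner_free n k A)"
proof -
  note par = corner_parameters[OF prime_ge_2_nat[OF assms(1)] assms(4-6)]
  have ab: "0 < real (a choose b)" using par(2) by simp
  define sizes where "sizes n = card ` {F. packing a b {..<n} F}" for n :: nat
  have fin: "finite (sizes n)" for n
  proof -
    have "{F. packing a b {..<n} F} \<subseteq> Pow (Pow {..<n})" by (auto simp: packing_def)
    then have "finite {F. packing a b {..<n} F}" by (rule finite_subset) simp
    then show ?thesis by (simp add: sizes_def)
  qed
  \<comment> \<open>\<open>asymptotic_packing\<close> treats one \<open>\<delta>\<close> at a time;
    packings of maximum size give a single error function that is good for every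
    \<open>\<delta>\<close>.\<close>
  define f where "f n = Max (sizes n)" for n
  have "packing a b {..<n} {}" for n by (simp add: packing_def)
  then have "f n \<in> sizes n" for n
    unfolding f_def using fin by (intro Max_in) (auto simp: sizes_def)
  then have "\<exists>F. packing a b {..<n} F \<and> f n = card F" for n
    by (auto simp: sizes_def image_iff)
  then obtain F where F: "\<And>n. packing a b {..<n} (F n)" "\<And>n. f n = card (F n)" by metis
  have le_f: "card F' \<le> f n" if "packing a b {..<n} F'" for n F'
    unfolding f_def using that fin by (intro Max_ge) (auto simp: sizes_def)
  \<comment> \<open>Truncation at 0 lets convergence follow from lower bounds on \<open>f n\<close>
    alone. For \<open>n < b\<close> the quotient is 0 by convention and the claimed bound is
    trivial.\<close>
  define \<epsilon> where "\<epsilon> n = max 0 (1 - real (f n) * real (a choose b) / real (n choose b))" for n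
  have "\<epsilon> \<longlonglongrightarrow> 0"
  proof (rule LIMSEQ_I)
    fix d :: real assume d: "0 < d"
    obtain n0 where n0: "\<And>n. n \<ge> n0 \<Longrightarrow> \<exists>F. packing a b {..<n} F \<and>
        (1 - d / 2) * real (n choose b) \<le> real (card F) * real (a choose b)"
      using asymptotic_packing[OF par(1,2), of "d / 2"] d by auto
    have "norm (\<epsilon> n - 0) < d" if n: "n \<ge> max n0 b" for n
    proof -
      have nb: "0 < real (n choose b)" using n by simp
      obtain F' where F': "packing a b {..<n} F'"
        "(1 - d / 2) * real (n choose b) \<le> real (card F') * real (a choose b)"
        using n0 n by auto
      note F'(2)
      also have "real (card F') * real (a choose b) \<le> real (f n) * real (a choose b)"
        using le_f[OF F'(1)] by (intro mult_right_mono) auto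
      finally have "1 - d / 2 \<le> real (f n) * real (a choose b) / real (n choose b)"
        using nb by (simp add: field_simps)
      then show ?thesis using d by (simp add: \<epsilon>_def max_def)
    qed
    then show "\<exists>n0. \<forall>n\<ge>n0. norm (\<epsilon> n - 0) < d" by blast
  qed
  moreover have "\<exists>A :: 'a vec set. A \<subseteq> carrier_vec n \<and>
       real (card A) \<ge> (1 - \<epsilon> n) * real (n choose b) / real (a choose b) \<and>
       right_corner_free n k A" for n
  proof (intro exI[of _ "indicator_vec n ` F n"] conjI)
    show "indicator_vec n ` F n \<subseteq> carrier_vec n" by (auto simp: indicator_vec_def)
    show "right_corner_free n k (indicator_vec n ` F n :: 'a vec set)"
      using assms(1,3) par by (intro packing_right_corner_free[OF _ F(1) par(2) _ par(4)]) simp_all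
    have "F n \<subseteq> Pow {..<n}" using F(1)[of n] by (force simp: packing_def)
    then have "card (indicator_vec n ` F n :: 'a vec set) = f n"
      using F(2) inj_on_indicator_vec by (metis card_image inj_on_subset)
    moreover have "(1 - \<epsilon> n) * real (n choose b) \<le> real (f n) * real (a choose b)"
    proof (cases "n choose b = 0")
      case False
      then have nb: "0 < real (n choose b)" by simp
      have "1 - \<epsilon> n \<le> real (f n) * real (a choose b) / real (n choose b)"
        by (simp add: \<epsilon>_def)
      then show ?thesis using nb by (simp add: field_simps)
    next
      case True
      then have "real (n choose b) = 0" by (simp only: of_nat_0)
      then show ?thesis by (simp only: mult_zero_right) simp
    qed
    ultimately show "(1 - \<epsilon> n) * real (n choose b) / real (a choose b)
        \<le> real (card (indicator_vec n ` F n :: 'a vec set))"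
      using ab by (simp add: field_simps)
  qed
  ultimately show ?thesis by blast
qed

end
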